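(* Let $\gamma$ be the forward unit speed geodesic in the Funk disc $(\mathbb{D},F_F)$ with initial point $p\in\mathbb{D}$ and forward hitting point $y\in\partial\mathbb{D}$, and let $b_\gamma$ be its forward Busemann function. Then $\overrightarrow{\Delta}_{BH}\,b_\gamma(x)=-2$ for all $x\in\mathbb{D}$.
   Context: $\mathbb{D}=\{x\in\mathbb{R}^2:|x|<1\}$, with $|\cdot|$ and $\langle\cdot,\cdot\rangle$ the Euclidean norm and inner product. The Funk metric is $F=F_F$, $F_F(x,v)=\dfrac{\sqrt{(1-|x|^2)|v|^2+\langle x,v\rangle^2}}{1-|x|^2}+\dfrac{\langle x,v\rangle}{1-|x|^2}$. Its (asymmetric) distance is $d_F(x_1,x_2)=\ln\dfrac{|x_1-a|}{|x_2-a|}$ for $x_1\neq x_2$, where $a$ is the point at which the ray from $x_1$ through $x_2$ meets $\partial\mathbb{D}$ (and $d_F(x,x)=0$). The forward geodesic is $\gamma(t)=e^{-t}p+(1-e^{-t})y$, $t\ge 0$, and $b_\gamma(x)=\lim_{t\to\infty}\{t-d_F(x,\gamma(t))\}$. The dual metric is $F^*(x,\xi)=\sup_{F(x,v)=1}\xi(v)$, $\xi\in T_x^*\mathbb{D}$, and $g^{*ij}(x,\xi)=\dfrac12\dfrac{\partial^2[F^{*2}]}{\partial\xi_i\partial\xi_j}(x,\xi)$ for $\xi\neq0$. For a volume density $\sigma_\mu$ (volume form $\sigma_\mu(x)\,dx$), the forward Shen Laplacian of a $C^2$ function $f$ is, at points where $df_x\ne0$, $$\overrightarrow{\Delta}_\mu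 f(x)=\frac{1}{\sigma_\mu(x)}\frac{\partial}{\partial x^i}\Big(\sigma_\mu(x)\,g^{*ij}(x,df_x)\frac{\partial f}{\partial x^j}(x)\Big)$$ (summation over repeated indices). $\overrightarrow{\Delta}_{BH}$ is taken with respect to the Busemann-Hausdorff density $\sigma_{BH}(x)=\dfrac{\mathrm{vol}(B^2(1))}{\mathrm{vol}\{v\in\mathbb{R}^2:F(x,v)<1\}}$, with vol the Euclidean area and $B^2(1)$ the Euclidean unit disc. *)

theory Defs
  imports "HOL-Analysis.Analysis"
begin

text \<open>
  A covector \<open>\<xi>\<close> at a point is represented by the vector of its coordinates \<open>\<xi>\<^sub>i\<close>, so that
  \<open>\<xi>(v) = \<xi> \<bullet> v\<close>.  A metric \<open>F\<close> takes a base point and a tangent vector.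
\<close>

definition partial :: "'n::finite \<Rightarrow> (real^'n \<Rightarrow> real) \<Rightarrow> real^'n \<Rightarrow> real" where
  "partial i f x = deriv (\<lambda>s. f (x + s *\<^sub>R axis i 1)) 0"

definition differential :: "(real^'n::finite \<Rightarrow> real) \<Rightarrow> real^'n \<Rightarrow> real^'n" where
  "differential f x = (\<chi> i. partial i f x)"

text \<open>Used for open \<open>S\<close> only.\<close>

definition C2_on :: "(real^'n::finite) set \<Rightarrow> (real^'n \<Rightarrow> real) \<Rightarrow> bool" where
  "C2_on S f \<longleftrightarrow> f differentiable_on S \<and>
     (\<forall>i. partial i f differentiable_on S \<and>
       (\<forall>j. continuous_on S (partial j (partial i f))))"

definition dual_metric ::
    "(real^'n::finite \<Rightarrow> real^'n \<Rightarrow> real) \<Rightarrow> real^'n \<Rightarrow> real^'n \<Rightarrow> real" where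
  "dual_metric F x \<xi> = (SUP v\<in>{v. F x v = 1}. \<xi> \<bullet> v)"

definition dual_tensor ::
    "(real^'n::finite \<Rightarrow> real^'n \<Rightarrow> real) \<Rightarrow> real^'n \<Rightarrow> real^'n \<Rightarrow> 'n \<Rightarrow> 'n \<Rightarrow> real" where
  "dual_tensor F x \<xi> i j = 1/2 * partial i (partial j (\<lambda>\<eta>. (dual_metric F x \<eta>)\<^sup>2)) \<xi>"

text \<open>Meaningful for \<open>C\<^sup>2\<close> functions \<open>f\<close>, at points where the differential of \<open>f\<close> is nonzero.\<close>

definition shen_laplacian ::
    "(real^'n::finite \<Rightarrow> real^'n \<Rightarrow> real) \<Rightarrow> (real^'n \<Rightarrow> real) \<Rightarrow> (real^'n \<Rightarrow> real) \<Rightarrow> real^'n \<Rightarrow> real"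
  where
  "shen_laplacian F \<sigma> f x =
     1 / \<sigma> x * (\<Sum>i\<in>UNIV. partial i
       (\<lambda>z. \<sigma> z * (\<Sum>j\<in>UNIV. dual_tensor F z (differential f z) i j * partial j f z)) x)"

definition BH_density ::
    "(real^'n::finite \<Rightarrow> real^'n \<Rightarrow> real) \<Rightarrow> real^'n \<Rightarrow> real" where
  "BH_density F x = measure lebesgue (ball (0::real^'n) 1) / measure lebesgue {v. F x v < 1}"

definition funk_metric :: "real^2 \<Rightarrow> real^2 \<Rightarrow> real" where
  "funk_metric x v =
     sqrt ((1 - (norm x)\<^sup>2) * (norm v)\<^sup>2 + (x \<bullet> v)\<^sup>2) / (1 - (norm x)\<^sup>2)
     + (x \<bullet> v) / (1 - (norm x)\<^sup>2)"

text \<open>The point where the ray from \<open>x\<^sub>1\<close> through \<open>x\<^sub>2 \<noteq> x\<^sub>1\<close> leaves the unit disc; it exists and is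
  unique for \<open>x\<^sub>1\<close> in the open disc.\<close>

definition exit_point :: "real^2 \<Rightarrow> real^2 \<Rightarrow> real^2" where
  "exit_point x\<^sub>1 x\<^sub>2 = (THE a. a \<in> sphere 0 1 \<and> (\<exists>s\<ge>0. a = x\<^sub>1 + s *\<^sub>R (x\<^sub>2 - x\<^sub>1)))"

definition funk_dist :: "real^2 \<Rightarrow> real^2 \<Rightarrow> real" where
  "funk_dist x\<^sub>1 x\<^sub>2 =
     (if x\<^sub>1 = x\<^sub>2 then 0
      else ln (norm (x\<^sub>1 - exit_point x\<^sub>1 x\<^sub>2) / norm (x\<^sub>2 - exit_point x\<^sub>1 x\<^sub>2)))"

definition funk_geodesic :: "real^2 \<Rightarrow> real^2 \<Rightarrow> real \<Rightarrow> real^2" where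
  "funk_geodesic p y t = exp (- t) *\<^sub>R p + (1 - exp (- t)) *\<^sub>R y"

definition funk_busemann :: "(real \<Rightarrow> real^2) \<Rightarrow> real^2 \<Rightarrow> real" where
  "funk_busemann \<gamma> x = Lim at_top (\<lambda>t. t - funk_dist x (\<gamma> t))"

end

theory Submission
  imports Defs
begin

text \<open>
  The unit ball of \<open>F x\<close> is the translated disc \<open>ball 0 1 - x\<close>.  Hence the Busemann-Hausdorff
  density is 1, the dual metric is \<open>F\<^sup>*(x,\<xi>) = \<bar>\<xi>\<bar> - \<langle>\<xi>,x\<rangle>\<close>, and the distance is
  \<open>d(x,z) = - ln (1 - F x (z - x))\<close>.  Expanding the latter along the geodesic gives
  \<open>b x = ln ((1 - \<langle>y,p\<rangle>) / (1 - \<langle>x,y\<rangle>))\<close>, whose differential \<open>y / (1 - \<langle>x,y\<rangle>)\<close> is sent by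
  the Legendre transform to the vector \<open>y - x\<close>.  The Laplacian is the Euclidean divergence of
  this field.
\<close>

section \<open>Partial derivatives\<close>

text \<open>The chain rule along a coordinate line; every partial derivative below is then read off
  from a Frechet derivative.\<close>

lemma partial_eq_derivative:
  assumes "(f has_derivative f') (at x)"
  shows "partial i f x = f' (axis i 1)"
proof -
  have lin: "linear f'" using assms has_derivative_linear by blast
  have "((\<lambda>s. x + s *\<^sub>R axis i 1) has_derivative (\<lambda>s. s *\<^sub>R axis i (1::real))) (at (0::real))"
    by (auto intro!: derivative_eq_intros)
  then have "((\<lambda>s. f (x + s *\<^sub>R axis i 1)) has_derivative (\<lambda>s. f' (s *\<^sub>R axis i 1))) (at (0::real))"
    by (rule has_derivative_compose) (use assms in simp)
  moreover have "(\<lambda>s. f' (s *\<^sub>R axis i 1)) = (*) (f' (axis i 1))"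
    using lin by (auto simp: linear_cmul)
  ultimately have "((\<lambda>s. f (x + s *\<^sub>R axis i 1)) has_field_derivative f' (axis i 1)) (at 0)"
    by (simp add: has_field_derivative_def)
  then show ?thesis
    unfolding partial_def by (rule DERIV_imp_deriv)
qed

text \<open>Closed forms are available only on the disc or away from the zero covector. A partial
  derivative depends only on values near the point, so agreement on an open set is enough.\<close>

lemma partial_cong_open:
  assumes "open S" "x \<in> S" "\<And>z. z \<in> S \<Longrightarrow> f z = g z"
  shows "partial i f x = partial i g x"
proof -
  have "((\<lambda>s. x + s *\<^sub>R axis i (1::real)) \<longlongrightarrow> x + 0 *\<^sub>R axis i 1) (nhds (0::real))"
    by (intro tendsto_intros filterlim_ident)
  then have "eventually (\<lambda>s. x + s *\<^sub>R axis i 1 \<in> S) (nhds (0::real))"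
    using assms by (auto dest: topological_tendstoD)
  then have "eventually (\<lambda>s. f (x + s *\<^sub>R axis i 1) = g (x + s *\<^sub>R axis i 1)) (nhds (0::real))"
    by eventually_elim (use assms in auto)
  then show ?thesis
    unfolding partial_def by (intro deriv_cong_ev refl)
qed

section \<open>The indicatrix of the Funk metric\<close>

lemma one_minus_norm_sq_pos: "x \<in> ball 0 1 \<Longrightarrow> 0 < 1 - (norm x)\<^sup>2"
  by (simp add: abs_square_less_1)

text \<open>\<open>F x v\<close> is the nonnegative root of \<open>\<lambda>\<^sup>2 - \<bar>\<lambda> x + v\<bar>\<^sup>2\<close>; this is its factorization at
  \<open>\<lambda> = 1\<close>.\<close>

lemma funk_metric_factor:
  assumes x: "x \<in> ball 0 1"
  shows "(1 - funk_metric x v)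
      * (1 - (norm x)\<^sup>2 - x \<bullet> v + sqrt ((1 - (norm x)\<^sup>2) * (norm v)\<^sup>2 + (x \<bullet> v)\<^sup>2))
    = 1 - (norm (x + v))\<^sup>2"
proof -
  define D where "D = 1 - (norm x)\<^sup>2"
  define R where "R = sqrt (D * (norm v)\<^sup>2 + (x \<bullet> v)\<^sup>2)"
  have D: "D > 0" using one_minus_norm_sq_pos[OF x] by (simp add: D_def)
  have R: "R\<^sup>2 = D * (norm v)\<^sup>2 + (x \<bullet> v)\<^sup>2" using D by (simp add: R_def)
  have F: "funk_metric x v = (R + x \<bullet> v) / D"
    by (simp add: funk_metric_def D_def R_def add_divide_distrib)
  have n: "(norm (x + v))\<^sup>2 = 1 - D + 2 * (x \<bullet> v) + (norm v)\<^sup>2"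
    by (simp add: D_def power2_norm_eq_inner inner_add_left inner_add_right inner_commute)
  \<comment> \<open>A difference of squares: only the square of \<open>R\<close> enters, the square
    of \<open>x \<bullet> v\<close> cancels, and a multiple of \<open>D\<close> remains.\<close>
  have "(D - (R + x \<bullet> v)) * (D - x \<bullet> v + R) = D * (D - 2 * (x \<bullet> v) - (norm v)\<^sup>2)"
    using R by (simp add: power2_eq_square algebra_simps)
  then have "(1 - (R + x \<bullet> v) / D) * (D - x \<bullet> v + R) = D - 2 * (x \<bullet> v) - (norm v)\<^sup>2"
    using D by (simp add: field_simps)
  then show ?thesis
    using F n by (simp add: D_def R_def)
qed

text \<open>The square root dominates \<open>x \<bullet> v\<close>, so at least
  \<open>1 - (norm x)\<^sup>2\<close> is left over.\<close>

lemma funk_metric_cofactor_pos: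
  assumes x: "x \<in> ball 0 1"
  shows "0 < 1 - (norm x)\<^sup>2 - x \<bullet> v + sqrt ((1 - (norm x)\<^sup>2) * (norm v)\<^sup>2 + (x \<bullet> v)\<^sup>2)"
proof -
  have "x \<bullet> v \<le> sqrt ((1 - (norm x)\<^sup>2) * (norm v)\<^sup>2 + (x \<bullet> v)\<^sup>2)"
    using one_minus_norm_sq_pos[OF x] by (intro real_le_rsqrt) simp
  then show ?thesis
    using one_minus_norm_sq_pos[OF x] by linarith
qed

text \<open>Dividing the factorization by its positive cofactor shows that
  \<open>1 - funk_metric x v\<close> has the sign of
  \<open>1 - (norm (x + v))\<^sup>2\<close>.\<close>

lemma
  assumes x: "x \<in> ball 0 1"
  shows funk_metric_less_1_iff: "funk_metric x v < 1 \<longleftrightarrow> norm (x + v) < 1"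
    and funk_metric_eq_1_iff: "funk_metric x v = 1 \<longleftrightarrow> norm (x + v) = 1"
proof -
  note f = funk_metric_factor[OF x, of v] and c = funk_metric_cofactor_pos[OF x, of v]
  have "funk_metric x v < 1 \<longleftrightarrow> 0 < 1 - (norm (x + v))\<^sup>2"
    unfolding f[symmetric] using c by (simp add: zero_less_mult_iff)
  also have "\<dots> \<longleftrightarrow> norm (x + v) < 1"
    by (simp add: abs_square_less_1)
  finally show "funk_metric x v < 1 \<longleftrightarrow> norm (x + v) < 1" .
  have "funk_metric x v = 1 \<longleftrightarrow> 1 - (norm (x + v))\<^sup>2 = 0"
    unfolding f[symmetric] using c by auto
  also have "\<dots> \<longleftrightarrow> norm (x + v) = 1"
    by (simp add: power2_eq_1_iff) (use norm_ge_zero[of "x + v"] in linarith)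
  finally show "funk_metric x v = 1 \<longleftrightarrow> norm (x + v) = 1" .
qed

lemma funk_metric_scaleR:
  assumes "s \<ge> 0"
  shows "funk_metric x (s *\<^sub>R v) = s * funk_metric x v"
proof -
  have "sqrt ((1 - (norm x)\<^sup>2) * (norm (s *\<^sub>R v))\<^sup>2 + (x \<bullet> (s *\<^sub>R v))\<^sup>2)
      = sqrt (s\<^sup>2 * ((1 - (norm x)\<^sup>2) * (norm v)\<^sup>2 + (x \<bullet> v)\<^sup>2))"
    by (simp add: power_mult_distrib algebra_simps)
  also have "\<dots> = s * sqrt ((1 - (norm x)\<^sup>2) * (norm v)\<^sup>2 + (x \<bullet> v)\<^sup>2)"
    unfolding real_sqrt_mult using assms by simp
  finally show ?thesis
    unfolding funk_metric_def by (simp add: distrib_left)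
qed

lemma funk_metric_pos:
  assumes x: "x \<in> ball 0 1" and "v \<noteq> 0"
  shows "0 < funk_metric x v"
proof -
  have D: "0 < 1 - (norm x)\<^sup>2" using one_minus_norm_sq_pos[OF x] .
  have "\<bar>x \<bullet> v\<bar> < sqrt ((1 - (norm x)\<^sup>2) * (norm v)\<^sup>2 + (x \<bullet> v)\<^sup>2)"
    using D assms(2) by (intro real_less_rsqrt) simp
  then have "0 < sqrt ((1 - (norm x)\<^sup>2) * (norm v)\<^sup>2 + (x \<bullet> v)\<^sup>2) + x \<bullet> v" by linarith
  then show ?thesis
    using D by (simp add: funk_metric_def flip: add_divide_distrib)
qed

lemma BH_density_funk:
  assumes x: "x \<in> ball 0 1"
  shows "BH_density funk_metric x = 1"
proof -
  have "{v. funk_metric x v < 1} = {v. x + v \<in> ball 0 1}"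
    using funk_metric_less_1_iff[OF x] by simp
  also have "\<dots> = (+) (- x) ` ball 0 1"
    by (force simp: image_iff)
  finally have "{v. funk_metric x v < 1} = (+) (- x) ` ball 0 1" .
  then have "measure lebesgue {v. funk_metric x v < 1} = measure lebesgue (ball (0::real^2) 1)"
    by (simp only: measure_translation)
  then show ?thesis
    using content_ball_pos[of 1 "0::real^2"] by (simp add: BH_density_def)
qed

section \<open>The distance and the Busemann function\<close>

text \<open>By homogeneity, the point of the ray with parameter \<open>s\<close> lies on the circle
  exactly when \<open>s * funk_metric x (z - x) = 1\<close>.\<close>

lemma exit_point_eq:
  assumes x: "x \<in> ball 0 1" and "z \<noteq> x"
  shows "exit_point x z = x + (1 / funk_metric x (z - x)) *\<^sub>R (z - x)"
proof -
  let ?k = "funk_metric x (z - x)"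
  have k: "?k > 0" using funk_metric_pos[OF x] assms by simp
  have iff: "norm (x + s *\<^sub>R (z - x)) = 1 \<longleftrightarrow> s = 1 / ?k" if "s \<ge> 0" for s
    using funk_metric_eq_1_iff[OF x, of "s *\<^sub>R (z - x)"] that k
    unfolding funk_metric_scaleR[OF that] by (simp add: eq_divide_eq)
  show ?thesis
    unfolding exit_point_def
    by (rule the_equality) (use iff k in \<open>auto intro!: exI[of _ "1 / ?k"]\<close>)
qed

text \<open>In units of \<open>norm (z - x)\<close>, the exit point is at distance
  \<open>1 / k\<close> from \<open>x\<close> and \<open>(1 - k) / k\<close> from \<open>z\<close>;
  the quotient is \<open>1 / (1 - k)\<close>.\<close>

lemma funk_dist_eq:
  assumes x: "x \<in> ball 0 1" and z: "z \<in> ball 0 1" and "z \<noteq> x"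
  shows "funk_dist x z = - ln (1 - funk_metric x (z - x))"
proof -
  define k where "k = funk_metric x (z - x)"
  have k: "k > 0" "k < 1"
    using funk_metric_pos[OF x, of "z - x"] funk_metric_less_1_iff[OF x, of "z - x"] assms
    by (auto simp: k_def)
  have n: "norm (z - x) > 0" using assms by simp
  have "x - exit_point x z = (- (1 / k)) *\<^sub>R (z - x)"
    using assms by (simp add: exit_point_eq k_def)
  then have 1: "norm (x - exit_point x z) = norm (z - x) / k"
    using k by simp
  have "z - exit_point x z = (1 - 1 / k) *\<^sub>R (z - x)"
    using assms by (simp add: exit_point_eq k_def algebra_simps)
  then have "norm (z - exit_point x z) = \<bar>1 - 1 / k\<bar> * norm (z - x)"
    by simp
  then have 2: "norm (z - exit_point x z) = (1 - k) * norm (z - x) / k"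
    using k by (simp add: abs_if diff_divide_distrib algebra_simps)
  have "norm (x - exit_point x z) / norm (z - exit_point x z) = inverse (1 - k)"
    unfolding 1 2 using k n by (simp add: field_simps)
  then show ?thesis
    using assms(3) k by (simp add: funk_dist_def ln_inverse k_def)
qed

lemma inner_less_1:
  assumes "x \<in> ball 0 1" "y \<in> sphere 0 1"
  shows "x \<bullet> y < (1::real)"
  using norm_cauchy_schwarz[of x y] assms by simp

text \<open>By the factorization, \<open>1 - funk_metric\<close> is
  \<open>1 - (norm (?g t))\<^sup>2\<close> divided by the cofactor \<open>G\<close>. The numerator
  splits off \<open>exp (- t)\<close>, whose logarithm cancels \<open>t\<close>; the rest has a
  positive limit.\<close>

lemma tendsto_funk_busemann:
  assumes p: "p \<in> ball 0 1" and y: "y \<in> sphere 0 1" and x: "x \<in> ball 0 1"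
  shows "((\<lambda>t. t - funk_dist x (funk_geodesic p y t)) \<longlongrightarrow> ln ((1 - p \<bullet> y) / (1 - x \<bullet> y))) at_top"
proof -
  let ?g = "funk_geodesic p y"
  define D where "D = 1 - (norm x)\<^sup>2"
  define G where "G v = D - x \<bullet> v + sqrt (D * (norm v)\<^sup>2 + (x \<bullet> v)\<^sup>2)" for v
  have e: "((\<lambda>t::real. exp (- t)) \<longlongrightarrow> 0) at_top"
    by (rule filterlim_compose[OF exp_at_bot]) (rule filterlim_uminus_at_bot_at_top)
  have g: "(?g \<longlongrightarrow> 0 *\<^sub>R p + (1 - 0) *\<^sub>R y) at_top"
    unfolding funk_geodesic_def by (intro tendsto_intros e)
  have yy: "y \<bullet> y = 1" using y by (simp add: norm_eq_1)
  \<comment> \<open>The limiting direction lies on the indicatrix, which determines the square root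
    in \<open>G (y - x)\<close>.\<close>
  have Fy: "funk_metric x (y - x) = 1"
    using funk_metric_eq_1_iff[OF x, of "y - x"] y by simp
  have Dpos: "D > 0" using one_minus_norm_sq_pos[OF x] by (simp add: D_def)
  have "G (y - x) = 2 * (1 - x \<bullet> y)"
  proof -
    have "(sqrt (D * (norm (y - x))\<^sup>2 + (x \<bullet> (y - x))\<^sup>2) + x \<bullet> (y - x)) / D = 1"
      using Fy by (simp add: funk_metric_def D_def add_divide_distrib)
    then have "sqrt (D * (norm (y - x))\<^sup>2 + (x \<bullet> (y - x))\<^sup>2) = D - x \<bullet> (y - x)"
      using Dpos by (simp add: field_simps)
    then show ?thesis
      by (simp add: G_def D_def inner_diff_right power2_norm_eq_inner)
  qed
  moreover have "((\<lambda>t. G (?g t - x)) \<longlongrightarrow> G (y - x)) at_top"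
    unfolding G_def using g by (intro tendsto_intros) auto
  ultimately have G: "((\<lambda>t. G (?g t - x)) \<longlongrightarrow> 2 * (1 - x \<bullet> y)) at_top" by simp
  \<comment> \<open>Since \<open>norm y = 1\<close>, the constant term vanishes and
    \<open>exp (- t)\<close> factors out; the other factor becomes \<open>q\<close>.\<close>
  have N: "1 - (norm (?g t))\<^sup>2 = exp (- t) * (2 * (1 - p \<bullet> y) - exp (- t) * (norm (y - p))\<^sup>2)" for t
  proof -
    have eq: "?g t = y - exp (- t) *\<^sub>R (y - p)"
      by (simp add: funk_geodesic_def algebra_simps)
    show ?thesis
      unfolding eq power2_norm_eq_inner
      by (simp add: inner_diff_left inner_diff_right yy inner_commute[of y p])
        (simp add: algebra_simps)
  qed
  define q where "q t = 2 * (1 - p \<bullet> y) - exp (- t) * (norm (y - p))\<^sup>2" for t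
  have "(q \<longlongrightarrow> 2 * (1 - p \<bullet> y) - 0 * (norm (y - p))\<^sup>2) at_top"
    unfolding q_def by (intro tendsto_intros e)
  then have q: "(q \<longlongrightarrow> 2 * (1 - p \<bullet> y)) at_top" by simp
  have xy: "x \<bullet> y < 1" and py: "p \<bullet> y < 1" using inner_less_1 assms by auto
  have lim: "((\<lambda>t. ln (q t / G (?g t - x))) \<longlongrightarrow> ln (2 * (1 - p \<bullet> y) / (2 * (1 - x \<bullet> y)))) at_top"
    using xy py by (intro tendsto_intros q G) auto
  have "y \<noteq> x" using x y by auto
  \<comment> \<open>The geodesic may pass through \<open>x\<close>, but not for large
    \<open>t\<close>, since its limit \<open>y\<close> differs from \<open>x\<close>.\<close>
  then have ne: "eventually (\<lambda>t. ?g t \<noteq> x) at_top"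
    using g tendsto_imp_eventually_ne by fastforce
  have pos: "eventually (\<lambda>t. q t > 0) at_top"
    using q py by (auto dest: order_tendstoD(1)[where a = 0])
  have "eventually (\<lambda>t. ln (q t / G (?g t - x)) = t - funk_dist x (?g t)) at_top"
    using ne pos
  proof eventually_elim
    case (elim t)
    have n: "1 - (norm (?g t))\<^sup>2 = exp (- t) * q t"
      using N by (simp add: q_def)
    then have "(norm (?g t))\<^sup>2 < 1" using elim by (smt (verit) exp_gt_zero mult_pos_pos)
    then have "?g t \<in> ball 0 1" by (simp add: abs_square_less_1)
    then have d: "funk_dist x (?g t) = - ln (1 - funk_metric x (?g t - x))"
      using funk_dist_eq[OF x] elim by blast
    have Gp: "G (?g t - x) > 0"
      using funk_metric_cofactor_pos[OF x] by (simp add: G_def D_def)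
    have "(1 - funk_metric x (?g t - x)) * G (?g t - x) = exp (- t) * q t"
      using funk_metric_factor[OF x, of "?g t - x"] n by (simp add: G_def D_def)
    then have "1 - funk_metric x (?g t - x) = exp (- t) * (q t / G (?g t - x))"
      using Gp by (simp add: field_simps)
    then show ?case
      unfolding d using elim Gp ln_mult_pos[of "exp (- t)" "q t / G (?g t - x)"] by simp
  qed
  with lim show ?thesis
    \<comment> \<open>This cancels the common factor 2 in the limit.\<close>
    unfolding mult_divide_mult_cancel_left[OF zero_neq_numeral[symmetric]]
    by (rule Lim_transform_eventually)
qed

lemma funk_busemann_eq:
  assumes "p \<in> ball 0 1" "y \<in> sphere 0 1" "x \<in> ball 0 1"
  shows "funk_busemann (funk_geodesic p y) x = ln ((1 - p \<bullet> y) / (1 - x \<bullet> y))"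
  unfolding funk_busemann_def
  by (rule tendsto_Lim[OF _ tendsto_funk_busemann[OF assms]]) simp

section \<open>The dual metric\<close>

text \<open>This is the support function of the unit circle translated by \<open>- x\<close>:
  Cauchy-Schwarz gives the bound, and \<open>u - x\<close> attains it for a unit vector
  \<open>u\<close> along \<open>\<xi>\<close>.\<close>

lemma dual_metric_funk:
  assumes x: "x \<in> ball 0 1"
  shows "dual_metric funk_metric x \<xi> = norm \<xi> - \<xi> \<bullet> x"
proof -
  obtain u :: "real^2" where u: "norm u = 1" "\<xi> = norm \<xi> *\<^sub>R u"
  proof (cases "\<xi> = 0")
    case True
    then show ?thesis using that[of "axis 1 1"] by simp
  next
    case False
    then show ?thesis using that[of "sgn \<xi>"] by (simp add: norm_sgn sgn_div_norm)
  qed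
  have "\<xi> \<bullet> (u - x) = norm \<xi> - \<xi> \<bullet> x"
    using u by (metis inner_diff_right inner_scaleR_left mult.right_neutral norm_eq_1)
  moreover have "\<xi> \<bullet> v \<le> norm \<xi> - \<xi> \<bullet> x" if "norm (x + v) = 1" for v
    using norm_cauchy_schwarz[of \<xi> "x + v"] that by (simp add: inner_add_right)
  moreover have "norm (x + (u - x)) = 1" using u by simp
  ultimately have "Sup ((\<lambda>v. \<xi> \<bullet> v) ` {v. norm (x + v) = 1}) = norm \<xi> - \<xi> \<bullet> x"
    by (intro cSup_eq_maximum) (auto intro!: image_eqI[of _ _ "u - x"])
  then show ?thesis
    using funk_metric_eq_1_iff[OF x] by (simp add: dual_metric_def)
qed

text \<open>Half the Hessian of a square is the outer square of the gradient plus the function times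
  its Hessian; here only the norm contributes to the latter.\<close>

lemma dual_tensor_funk:
  assumes x: "x \<in> ball 0 1" and \<xi>: "\<xi> \<noteq> 0"
  shows "dual_tensor funk_metric x \<xi> i j =
    (\<xi>$i / norm \<xi> - x$i) * (\<xi>$j / norm \<xi> - x$j)
    + (norm \<xi> - \<xi> \<bullet> x) * ((if i = j then 1 else 0) / norm \<xi> - \<xi>$i * \<xi>$j / norm \<xi> ^ 3)"
proof -
  have n: "(norm has_derivative (\<lambda>h. \<eta> \<bullet> h / norm \<eta>)) (at \<eta>)" if "\<eta> \<noteq> 0" for \<eta> :: "real^2"
    using has_derivative_norm[OF that]
    by (simp add: sgn_div_norm inner_commute divide_inverse mult.commute)
  note nth = bounded_linear_imp_has_derivative[OF bounded_linear_vec_nth]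
  have 1: "partial j (\<lambda>\<eta>. (dual_metric funk_metric x \<eta>)\<^sup>2) \<eta>
      = 2 * (norm \<eta> - \<eta> \<bullet> x) * (\<eta>$j / norm \<eta> - x$j)" if "\<eta> \<noteq> 0" for \<eta>
  proof -
    have "((\<lambda>\<eta>. (norm \<eta> - \<eta> \<bullet> x)\<^sup>2) has_derivative
        (\<lambda>h. 2 * (norm \<eta> - \<eta> \<bullet> x) * (\<eta> \<bullet> h / norm \<eta> - h \<bullet> x))) (at \<eta>)"
      using that
      by (auto intro!: derivative_eq_intros n simp: fun_eq_iff algebra_simps diff_divide_distrib)
    from partial_eq_derivative[OF this, of j] show ?thesis
      by (simp add: dual_metric_funk[OF x] inner_axis inner_axis')
  qed
  \<comment> \<open>The first derivative is known only off the origin, so the replacement is made on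
    that open set.\<close>
  have "partial i (partial j (\<lambda>\<eta>. (dual_metric funk_metric x \<eta>)\<^sup>2)) \<xi>
      = partial i (\<lambda>\<eta>. 2 * (norm \<eta> - \<eta> \<bullet> x) * (\<eta>$j / norm \<eta> - x$j)) \<xi>"
    by (rule partial_cong_open[of "- {0}"]) (use \<xi> 1 in auto)
  moreover have "((\<lambda>\<eta>. 2 * (norm \<eta> - \<eta> \<bullet> x) * (\<eta>$j / norm \<eta> - x$j)) has_derivative
      (\<lambda>h. 2 * (norm \<xi> - \<xi> \<bullet> x) * (h$j / norm \<xi> - \<xi>$j * (\<xi> \<bullet> h) / norm \<xi> ^ 3)
        + 2 * (\<xi> \<bullet> h / norm \<xi> - h \<bullet> x) * (\<xi>$j / norm \<xi> - x$j))) (at \<xi>)"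
  proof (rule has_derivative_mult)
    show "((\<lambda>\<eta>. 2 * (norm \<eta> - \<eta> \<bullet> x)) has_derivative
        (\<lambda>h. 2 * (\<xi> \<bullet> h / norm \<xi> - h \<bullet> x))) (at \<xi>)"
      using \<xi> by (auto intro!: derivative_eq_intros n)
    show "((\<lambda>\<eta>. \<eta>$j / norm \<eta> - x$j) has_derivative
        (\<lambda>h. h$j / norm \<xi> - \<xi>$j * (\<xi> \<bullet> h) / norm \<xi> ^ 3)) (at \<xi>)"
      using \<xi> by (auto intro!: derivative_eq_intros n nth
          simp: fun_eq_iff divide_inverse power3_eq_cube algebra_simps)
  qed
  note partial_eq_derivative[OF this, of i]
  ultimately have "dual_tensor funk_metric x \<xi> i j =
      (norm \<xi> - \<xi> \<bullet> x) * (axis i 1 $ j / norm \<xi> - \<xi>$j * (\<xi> \<bullet> axis i 1) / norm \<xi> ^ 3)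
      + (\<xi> \<bullet> axis i 1 / norm \<xi> - axis i 1 \<bullet> x) * (\<xi>$j / norm \<xi> - x$j)"
    by (simp only: dual_tensor_def distrib_left mult.assoc) simp
  moreover have "axis i (1::real) $ j = (if i = j then 1 else 0)"
    by (simp add: axis_def)
  ultimately show ?thesis
    by (simp only: inner_axis inner_axis' inner_real_def mult_1 mult_1_right add.commute mult.commute)
qed

text \<open>The Legendre transform of a covector \<open>c *\<^sub>R y\<close> with \<open>F\<^sup>*(x, c *\<^sub>R y) = 1\<close>.\<close>

lemma dual_tensor_funk_contract:
  assumes x: "x \<in> ball 0 1" and y: "y \<in> sphere 0 1" and c: "c > 0" "c * (1 - x \<bullet> y) = 1"
  shows "(\<Sum>j\<in>UNIV. dual_tensor funk_metric x (c *\<^sub>R y) i j * (c *\<^sub>R y)$j) = y$i - x$i"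
proof -
  have ny: "norm y = 1" "y \<noteq> 0" using y by auto
  \<comment> \<open>The tensor is homogeneous of degree 0 in the covector, so \<open>c\<close> drops
    out.\<close>
  have T: "dual_tensor funk_metric x (c *\<^sub>R y) i j = (y$i - x$i) * (y$j - x$j)
      + (1 - x \<bullet> y) * ((if i = j then 1 else 0) - y$i * y$j)" for j
  proof -
    have "(c - c * (x \<bullet> y)) * r / c = (1 - x \<bullet> y) * r" for r
      using c(1) by (simp add: field_simps)
    then show ?thesis
      using dual_tensor_funk[OF x, of "c *\<^sub>R y" i j] c(1) ny
      by (simp add: power3_eq_cube inner_commute[of y x] diff_divide_distrib right_diff_distrib)
  qed
  have yy: "(\<Sum>j\<in>UNIV. y$j * y$j) = 1"
    using ny by (simp add: norm_eq_1 inner_vec_def)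
  have xy: "(\<Sum>j\<in>UNIV. x$j * y$j) = x \<bullet> y"
    by (simp add: inner_vec_def)
  have "(\<Sum>j\<in>UNIV. dual_tensor funk_metric x (c *\<^sub>R y) i j * (c *\<^sub>R y)$j)
      = (\<Sum>j\<in>UNIV. c * ((y$i - x$i) * (y$j * y$j - x$j * y$j)
          + (1 - x \<bullet> y) * ((if i = j then y$j else 0) - y$i * (y$j * y$j))))"
    unfolding T by (rule sum.cong) (auto simp: algebra_simps)
  \<comment> \<open>The second summand comes from the projection orthogonal to \<open>y\<close>,
    which annihilates \<open>y\<close>.\<close>
  also have "\<dots> = c * ((y$i - x$i) * (1 - x \<bullet> y))"
    by (simp add: sum.distrib sum_subtractf yy xy flip: sum_distrib_left)
  also have "\<dots> = (y$i - x$i) * (c * (1 - x \<bullet> y))"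
    by simp
  finally show ?thesis using c by simp
qed

section \<open>The Laplacian of the Busemann function\<close>

text \<open>\<open>Lim\<close> and \<open>deriv\<close> are total, so the value \<open>-2\<close>
  alone would not show that the terms are meaningful. Convergence, regularity and a nonzero
  differential are therefore part of the conclusion.\<close>

theorem theorem7p1:
  fixes p y :: "real^2" and \<gamma> :: "real \<Rightarrow> real^2" and b :: "real^2 \<Rightarrow> real"
  assumes "p \<in> ball 0 1" and "y \<in> sphere 0 1"
  defines "\<gamma> \<equiv> funk_geodesic p y"
  defines "b \<equiv> funk_busemann \<gamma>"
  shows "(\<forall>x\<in>ball 0 1. \<exists>l. ((\<lambda>t. t - funk_dist x (\<gamma> t)) \<longlongrightarrow> l) at_top) \<and>
    C2_on (ball 0 1) b \<and>
    (\<forall>x\<in>ball 0 1. differential b x \<noteq> 0 \<and>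
       shen_laplacian funk_metric (BH_density funk_metric) b x = -2)"
proof -
  let ?B = "ball (0::real^2) 1"
  note py = inner_less_1[OF assms(1,2)] and xy = inner_less_1[OF _ assms(2)]
  \<comment> \<open>The initial point \<open>p\<close> enters only through an additive
    constant.\<close>
  have b: "b z = ln (1 - p \<bullet> y) - ln (1 - z \<bullet> y)" if "z \<in> ?B" for z
    using funk_busemann_eq[OF assms(1,2) that] xy[OF that] py by (simp add: b_def \<gamma>_def ln_div)
  have "((\<lambda>z. ln (1 - p \<bullet> y) - ln (1 - z \<bullet> y)) has_derivative (\<lambda>h. (h \<bullet> y) / (1 - z \<bullet> y))) (at z)"
    if "z \<in> ?B" for z
    using xy[OF that] by (auto intro!: derivative_eq_intros simp: field_simps)
  then have b': "(b has_derivative (\<lambda>h. (h \<bullet> y) / (1 - z \<bullet> y))) (at z)" if "z \<in> ?B" for z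
    by (rule has_derivative_transform_within_open[of _ _ _ UNIV ?B]) (use that b in auto)
  have pb: "partial i b z = y$i / (1 - z \<bullet> y)" if "z \<in> ?B" for i z
    using partial_eq_derivative[OF b'[OF that]] by (simp add: inner_axis')
  have "((\<lambda>z. y$i / (1 - z \<bullet> y)) has_derivative (\<lambda>h. y$i * (h \<bullet> y) / (1 - z \<bullet> y)\<^sup>2)) (at z)"
    if "z \<in> ?B" for i z
    using xy[OF that] by (auto intro!: derivative_eq_intros simp: power2_eq_square field_simps)
  then have pb': "(partial i b has_derivative (\<lambda>h. y$i * (h \<bullet> y) / (1 - z \<bullet> y)\<^sup>2)) (at z)"
    if "z \<in> ?B" for i z
    by (rule has_derivative_transform_within_open[of _ _ _ UNIV ?B]) (use that pb in auto)
  have ppb: "partial j (partial i b) z = y$i * y$j / (1 - z \<bullet> y)\<^sup>2" if "z \<in> ?B" for i j z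
    using partial_eq_derivative[OF pb'[OF that]] by (simp add: inner_axis')
  have "continuous_on ?B (\<lambda>z. y$i * y$j / (1 - z \<bullet> y)\<^sup>2)" for i j
    using xy by (intro continuous_intros) (metis less_irrefl right_minus_eq zero_eq_power2)
  then have "continuous_on ?B (partial j (partial i b))" for i j
    by (rule continuous_on_eq[of _ "\<lambda>z. y$i * y$j / (1 - z \<bullet> y)\<^sup>2"]) (use ppb in simp)
  then have C2: "C2_on ?B b"
    unfolding C2_on_def differentiable_on_def differentiable_def
    using b' pb' has_derivative_at_withinI by blast
  have db: "differential b z = (1 / (1 - z \<bullet> y)) *\<^sub>R y" if "z \<in> ?B" for z
    using pb[OF that] by (simp add: differential_def vec_eq_iff)
  \<comment> \<open>The differential is \<open>c *\<^sub>R y\<close> with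
    \<open>c = 1 / (1 - z \<bullet> y)\<close>, the normalization required by
    \<open>dual_tensor_funk_contract\<close>.\<close>
  have field: "BH_density funk_metric z
      * (\<Sum>j\<in>UNIV. dual_tensor funk_metric z (differential b z) i j * partial j b z) = y$i - z$i"
    if "z \<in> ?B" for z i
    using dual_tensor_funk_contract[OF that assms(2), of "1 / (1 - z \<bullet> y)" i] xy[OF that]
    by (simp add: BH_density_funk[OF that] db[OF that] pb[OF that])
  have "shen_laplacian funk_metric (BH_density funk_metric) b x = -2" if x: "x \<in> ?B" for x
  proof -
    \<comment> \<open>Each of the two coordinates contributes \<open>-1\<close> to the
      divergence.\<close>
    have "partial i (\<lambda>z. BH_density funk_metric z
        * (\<Sum>j\<in>UNIV. dual_tensor funk_metric z (differential b z) i j * partial j b z)) x = -1" for i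
    proof -
      have "((\<lambda>z. y$i - z$i) has_derivative (\<lambda>h. - (h$i))) (at x)"
        by (auto intro!: derivative_eq_intros
            bounded_linear_imp_has_derivative[OF bounded_linear_vec_nth])
      then have "partial i (\<lambda>z. y$i - z$i) x = -1"
        by (simp add: partial_eq_derivative)
      then show ?thesis
        by (simp only: partial_cong_open[OF open_ball x field])
    qed
    then show ?thesis
      by (simp add: shen_laplacian_def BH_density_funk[OF x])
  qed
  moreover have "differential b x \<noteq> 0" if "x \<in> ?B" for x
    using db[OF that] xy[OF that] assms(2) by auto
  moreover have "\<exists>l. ((\<lambda>t. t - funk_dist x (\<gamma> t)) \<longlongrightarrow> l) at_top" if "x \<in> ?B" for x
    using tendsto_funk_busemann[OF assms(1,2) that] by (auto simp: \<gamma>_def)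
  ultimately show ?thesis
    using C2 by blast
qed

end
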